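(* Let $\Sigma$ be a compact metric space and let $\mathcal{G}$ be a compact group acting continuously and transitively on $\Sigma$ via $\mathcal{G}\times\Sigma\to\Sigma$. Let $\mu$ be the unique $\mathcal{G}$-invariant Borel probability measure on $\Sigma$. Let $\mathcal{L}_1,\mathcal{L}_2$ be two laws of random continuous Hamiltonians $\Sigma\to\mathbb{R}$, and suppose that $\mathcal{L}_1$ is $\mathcal{G}$-invariant. Then $$F(\mathcal{L}_1+\mathcal{L}_2)\le F(\mathcal{L}_1)+F(\mathcal{L}_2).$$
   Context: A random Hamiltonian on $\Sigma$ is a random continuous function $H:\Sigma\to\mathbb{R}$; its law is denoted $\mathcal{L}$. The partition function is $Z(H)=\int_\Sigma e^{H(\sigma)}\,\mu(d\sigma)$, and the expected free energy is $F(\mathcal{L})=\mathbb{E}[\log Z(H)]$ for $H\sim\mathcal{L}$. All expected free energies considered ($F(\mathcal{L}_1)$, $F(\mathcal{L}_2)$ and $F(\mathcal{L}_1+\mathcal{L}_2)$) are assumed to be finite. Since $\Sigma$ and $\mathcal{G}$ are compact and the action is continuous and transitive, there is a unique Borel probability measure $\mu$ on $\Sigma$ such that, for $\sigma\sim\mu$, $\sigma$ and $g\sigma$ have the same law for every $g\in\mathcal{G}$; this is the $\mu$ used above (also in the definition of $Z$). The law $\mathcal{L}$ of $H$ is $\mathcal{G}$-invariant if for each $g\in\mathcal{G}$ the transformed Hamiltonian $H^g(\sigma)=H(g\sigma)$, $\sigma\in\Sigma$, also has law $\mathcal{L}$. $\mathcal{L}_1+\mathcal{L}_2$ denotes the law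 of the sum $H_1+H_2$ where $(H_1,H_2)\sim\mathcal{L}_1\times\mathcal{L}_2$ are independent. *)

theory Defs
  imports "HOL-Analysis.Analysis" "HOL-Probability.Probability" "HOL-Algebra.Group_Action"
begin

definition compact_topological_group :: "('g, 'm) monoid_scheme \<Rightarrow> 'g topology \<Rightarrow> bool" where
  "compact_topological_group G T \<longleftrightarrow>
     group G \<and> topspace T = carrier G \<and> compact_space T \<and>
     continuous_map (prod_topology T T) T (\<lambda>(g, h). g \<otimes>\<^bsub>G\<^esub> h) \<and>
     continuous_map T T (\<lambda>g. inv\<^bsub>G\<^esub> g)"

definition continuous_action ::
    "'g topology \<Rightarrow> ('g \<Rightarrow> 's::topological_space \<Rightarrow> 's) \<Rightarrow> bool" where
  "continuous_action T \<phi> \<longleftrightarrow>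
     continuous_map (prod_topology T euclidean) euclidean (\<lambda>(g, \<sigma>). \<phi> g \<sigma>)"

definition invariant_probability ::
    "('g, 'm) monoid_scheme \<Rightarrow> ('g \<Rightarrow> 's::topological_space \<Rightarrow> 's) \<Rightarrow> 's measure \<Rightarrow> bool" where
  "invariant_probability G \<phi> \<mu> \<longleftrightarrow>
     prob_space \<mu> \<and> sets \<mu> = sets borel \<and> (\<forall>g\<in>carrier G. distr \<mu> borel (\<phi> g) = \<mu>)"

text \<open>
  The continuous functions on \<open>\<Sigma>\<close>, with the \<open>\<sigma>\<close>-algebra generated by the evaluations
  \<open>H \<mapsto> H \<sigma>\<close>. For a compact metric space \<open>\<Sigma>\<close> this is also the Borel \<open>\<sigma>\<close>-algebra of the
  uniform norm.
\<close>
definition hamiltonian_space :: "('s::topological_space \<Rightarrow> real) measure" where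
  "hamiltonian_space = restrict_space (PiM UNIV (\<lambda>_. borel)) {H. continuous_on UNIV H}"

definition hamiltonian_law :: "('s::topological_space \<Rightarrow> real) measure \<Rightarrow> bool" where
  "hamiltonian_law L \<longleftrightarrow> prob_space L \<and> sets L = sets hamiltonian_space"

definition invariant_law ::
    "('g, 'm) monoid_scheme \<Rightarrow> ('g \<Rightarrow> 's::topological_space \<Rightarrow> 's) \<Rightarrow> ('s \<Rightarrow> real) measure \<Rightarrow> bool"
  where
  "invariant_law G \<phi> L \<longleftrightarrow>
     (\<forall>g\<in>carrier G. distr L hamiltonian_space (\<lambda>H \<sigma>. H (\<phi> g \<sigma>)) = L)"

definition sum_law ::
    "('s::topological_space \<Rightarrow> real) measure \<Rightarrow> ('s \<Rightarrow> real) measure \<Rightarrow> ('s \<Rightarrow> real) measure" where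
  "sum_law L\<^sub>1 L\<^sub>2 = distr (L\<^sub>1 \<Otimes>\<^sub>M L\<^sub>2) hamiltonian_space (\<lambda>(H\<^sub>1, H\<^sub>2) \<sigma>. H\<^sub>1 \<sigma> + H\<^sub>2 \<sigma>)"

definition partition_function :: "'s measure \<Rightarrow> ('s \<Rightarrow> real) \<Rightarrow> real" where
  "partition_function \<mu> H = (\<integral>\<sigma>. exp (H \<sigma>) \<partial>\<mu>)"

definition free_energy :: "'s measure \<Rightarrow> ('s \<Rightarrow> real) measure \<Rightarrow> real" where
  "free_energy \<mu> L = (\<integral>H. ln (partition_function \<mu> H) \<partial>L)"

text \<open>
  The Bochner integral of a non-integrable function is 0, so finiteness of the expectation
  defining \<open>free_energy\<close> has to be stated separately.
\<close>
definition finite_free_energy :: "'s measure \<Rightarrow> ('s \<Rightarrow> real) measure \<Rightarrow> bool" where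
  "finite_free_energy \<mu> L \<longleftrightarrow> integrable L (\<lambda>H. ln (partition_function \<mu> H))"

text \<open>
  The push-forwards in \<open>invariant_law\<close> and \<open>sum_law\<close> are along measurable maps.
\<close>

lemma measurable_hamiltonian_eval:
  "(\<lambda>H. H \<sigma>) \<in> borel_measurable (hamiltonian_space :: ('s::topological_space \<Rightarrow> real) measure)"
  unfolding hamiltonian_space_def by (intro measurable_restrict_space1) simp

lemma space_hamiltonian_space: "space hamiltonian_space = {H. continuous_on UNIV H}"
  by (auto simp: hamiltonian_space_def space_restrict_space space_PiM)

lemma measurable_hamiltonian_spaceI:
  assumes "\<And>x. x \<in> space M \<Longrightarrow> continuous_on UNIV (f x)"
    and "\<And>\<sigma>. (\<lambda>x. f x \<sigma>) \<in> borel_measurable M"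
  shows "f \<in> measurable M hamiltonian_space"
  unfolding hamiltonian_space_def
  using assms by (intro measurable_restrict_space2 measurable_PiM_single') auto

lemma measurable_hamiltonian_shift:
  assumes "continuous_on UNIV (f :: 's::topological_space \<Rightarrow> 's)"
  shows "(\<lambda>H \<sigma>. H (f \<sigma>)) \<in> measurable hamiltonian_space hamiltonian_space"
  by (rule measurable_hamiltonian_spaceI)
    (auto simp: space_hamiltonian_space measurable_hamiltonian_eval
      intro: continuous_on_compose2[OF _ assms])

lemma measurable_hamiltonian_sum:
  assumes "hamiltonian_law L\<^sub>1" "hamiltonian_law L\<^sub>2"
  shows "(\<lambda>(H\<^sub>1, H\<^sub>2) \<sigma>. H\<^sub>1 \<sigma> + H\<^sub>2 \<sigma>) \<in> measurable (L\<^sub>1 \<Otimes>\<^sub>M L\<^sub>2) hamiltonian_space"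
proof -
  have s: "sets L\<^sub>1 = sets hamiltonian_space" "sets L\<^sub>2 = sets hamiltonian_space"
    using assms by (auto simp: hamiltonian_law_def)
  have "(\<lambda>H. H \<sigma>) \<in> borel_measurable L\<^sub>1" "(\<lambda>H. H \<sigma>) \<in> borel_measurable L\<^sub>2" for \<sigma>
    using measurable_hamiltonian_eval s by (metis measurable_cong_sets)+
  then show ?thesis
    using sets_eq_imp_space_eq[OF s(1)] sets_eq_imp_space_eq[OF s(2)]
    by (intro measurable_hamiltonian_spaceI)
      (auto simp: space_pair_measure space_hamiltonian_space split_beta
        intro!: continuous_on_add borel_measurable_add
        intro: measurable_compose[OF measurable_fst] measurable_compose[OF measurable_snd])
qed

lemma hamiltonian_law_sum_law:
  assumes "hamiltonian_law L\<^sub>1" "hamiltonian_law L\<^sub>2"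
  shows "hamiltonian_law (sum_law L\<^sub>1 L\<^sub>2)"
proof -
  interpret L1: prob_space L\<^sub>1 using assms by (simp add: hamiltonian_law_def)
  interpret L2: prob_space L\<^sub>2 using assms by (simp add: hamiltonian_law_def)
  interpret pair_prob_space L\<^sub>1 L\<^sub>2 ..
  show ?thesis
    unfolding hamiltonian_law_def sum_law_def
    using prob_space_distr[OF measurable_hamiltonian_sum[OF assms]] by simp
qed

end

theory Submission
  imports Defs
begin

text \<open>
  Condition on \<open>H\<^sub>2\<close> and put \<open>w = exp H\<^sub>2\<close>. For a positive continuous weight \<open>u\<close> let \<open>\<Phi> u\<close> be the
  expectation over \<open>H\<^sub>1\<close> of \<open>log (\<integral> exp H\<^sub>1 \<cdot> u d\<mu>)\<close>. The heart of the matter is the bound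
  \<open>\<Phi> w \<le> log (\<integral> w d\<mu>) + F(L\<^sub>1)\<close> (\<open>weighted_free_energy_le\<close>), an equality for constant weights;
  integrating it over \<open>H\<^sub>2\<close> gives the theorem.

  The functional \<open>\<Phi>\<close> is concave, because the logarithm is, and it does not change when \<open>u\<close> is
  replaced by a translate \<open>\<sigma> \<mapsto> u (g \<sigma>)\<close>: by invariance of \<open>\<mu>\<close> the translation can be moved
  onto \<open>H\<^sub>1\<close>, whose law is invariant. Hence averaging \<open>u\<close> over finitely many translates can only
  increase \<open>\<Phi>\<close> (\<open>weighted_free_energy_le_average\<close>), while the integral of \<open>u\<close> stays the same.

  Averages over the Haar measure of the group would turn \<open>w\<close> into the constant \<open>\<integral> w d\<mu>\<close> in one
  step. Finite averages are enough: iterating one suitable finite average brings \<open>w\<close> uniformly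
  below \<open>\<integral> w d\<mu> + \<epsilon>\<close> (\<open>exists_near_constant_average\<close>), and an upper bound on the weight is all
  that is used, since \<open>\<Phi>\<close> is monotone. The finite average is taken over group elements that move
  every point \<open>\<delta>\<close>-close to every other point; these exist by transitivity and compactness. Each
  application pulls the maximum towards the mean by a fixed factor, provided all iterates share
  one modulus of continuity, and they do because the translates of \<open>w\<close> are uniformly
  equicontinuous.

  The integrand of \<open>\<Phi> w\<close> is measurable for almost every \<open>H\<^sub>2\<close>, being a section of the integrable
  function \<open>(H\<^sub>1, H\<^sub>2) \<mapsto> log Z(H\<^sub>1 + H\<^sub>2)\<close>; translating and averaging the weight preserve
  measurability.
\<close>

section \<open>Compact homogeneous spaces\<close>

locale compact_homogeneous_space =
  fixes G :: "('g, 'm) monoid_scheme" and T :: "'g topology"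
    and \<phi> :: "'g \<Rightarrow> 's::metric_space \<Rightarrow> 's"
    and \<mu> :: "'s measure"
  assumes compact_UNIV: "compact (UNIV :: 's set)"
    and compact_group: "compact_topological_group G T"
    and transitive: "transitive_action G UNIV \<phi>"
    and continuous: "continuous_action T \<phi>"
    and invariant: "invariant_probability G \<phi> \<mu>"
begin

sublocale transitive_action G UNIV \<phi> by (rule transitive)

sublocale prob_space \<mu>
  using invariant by (simp add: invariant_probability_def)

lemma group_G: "group G"
  using compact_group by (simp add: compact_topological_group_def)

lemma sets_mu [measurable_cong]: "sets \<mu> = sets borel"
  using invariant by (simp add: invariant_probability_def)

lemma topspace_T: "topspace T = carrier G"
  using compact_group by (simp add: compact_topological_group_def)

lemma continuous_translate:
  assumes "g \<in> carrier G"
  shows "continuous_on UNIV (\<phi> g)"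
proof -
  have "continuous_map euclidean (prod_topology T euclidean) (\<lambda>\<sigma>::'s. (g, \<sigma>))"
    using assms by (auto intro!: continuous_map_pairedI simp: topspace_T)
  from continuous_map_compose[OF this continuous[unfolded continuous_action_def]]
  show ?thesis by (simp add: o_def)
qed

lemma continuous_on_translate:
  assumes "g \<in> carrier G" "continuous_on UNIV (u :: 's \<Rightarrow> real)"
  shows "continuous_on UNIV (\<lambda>\<sigma>. u (\<phi> g \<sigma>))"
  using continuous_on_compose2[OF assms(2) continuous_translate[OF assms(1)]] by simp

lemma integrable_of_continuous:
  assumes "continuous_on UNIV (u :: 's \<Rightarrow> real)"
  shows "integrable \<mu> u"
proof -
  have "bounded (range u)"
    using compact_continuous_image[OF assms compact_UNIV] compact_imp_bounded by blast
  then obtain B where "\<And>x. norm (u x) \<le> B"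
    by (auto simp: bounded_iff)
  moreover have "u \<in> borel_measurable \<mu>"
    using borel_measurable_continuous_onI[OF assms] by (simp cong: measurable_cong_sets add: sets_mu)
  ultimately show ?thesis
    by (intro integrable_const_bound[where B = B]) auto
qed

lemma integral_pos_of_continuous:
  assumes u: "continuous_on UNIV (u :: 's \<Rightarrow> real)" and pos: "\<And>\<sigma>. 0 < u \<sigma>"
  shows "0 < (\<integral>\<sigma>. u \<sigma> \<partial>\<mu>)"
proof -
  obtain x where x: "\<And>y. u x \<le> u y"
    using continuous_attains_inf[OF compact_UNIV _ u] by auto
  then have "u x \<le> (\<integral>\<sigma>. u \<sigma> \<partial>\<mu>)"
    by (intro integral_ge_const integrable_of_continuous u) auto
  then show ?thesis using pos[of x] by linarith
qed

lemma integral_translate: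
  assumes g: "g \<in> carrier G" and u: "continuous_on UNIV (u :: 's \<Rightarrow> real)"
  shows "(\<integral>\<sigma>. u (\<phi> g \<sigma>) \<partial>\<mu>) = (\<integral>\<sigma>. u \<sigma> \<partial>\<mu>)"
proof -
  have "\<phi> g \<in> measurable \<mu> borel"
    using borel_measurable_continuous_onI[OF continuous_translate[OF g]]
    by (simp cong: measurable_cong_sets add: sets_mu)
  then have "(\<integral>\<sigma>. u (\<phi> g \<sigma>) \<partial>\<mu>) = (\<integral>\<sigma>. u \<sigma> \<partial>distr \<mu> borel (\<phi> g))"
    by (intro integral_distr[symmetric] borel_measurable_continuous_onI[OF u])
  also have "distr \<mu> borel (\<phi> g) = \<mu>"
    using invariant g by (simp add: invariant_probability_def)
  finally show ?thesis .
qed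

section \<open>Equicontinuity of translates and approximate transitivity\<close>

text \<open>
  The bound is imposed on all translates of \<open>u\<close> at once, so that it is inherited by averages of
  translates with the same \<open>\<delta>\<close> and \<open>\<epsilon>\<close>.
\<close>
definition translates_modulus :: "('s \<Rightarrow> real) \<Rightarrow> real \<Rightarrow> real \<Rightarrow> bool" where
  "translates_modulus u \<delta> \<epsilon> \<longleftrightarrow>
     (\<forall>g\<in>carrier G. \<forall>x y. dist x y < \<delta> \<longrightarrow> \<bar>u (\<phi> g x) - u (\<phi> g y)\<bar> \<le> \<epsilon>)"

text \<open>
  The triples \<open>(g, x, y)\<close> at which \<open>u (g x)\<close> and \<open>u (g y)\<close> differ by at least \<open>\<epsilon>\<close> form a closed,
  hence compact, subset of \<open>G \<times> \<Sigma> \<times> \<Sigma>\<close> on which \<open>dist x y\<close> never vanishes; so \<open>dist x y\<close> is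
  bounded away from 0 there. This is where compactness of the group enters.
\<close>
lemma translates_modulus_exists:
  assumes u: "continuous_on UNIV (u :: 's \<Rightarrow> real)" and "0 < \<epsilon>"
  shows "\<exists>\<delta>>0. translates_modulus u \<delta> \<epsilon>"
proof -
  let ?P = "prod_topology T (euclidean :: ('s \<times> 's) topology)"
  let ?f = "\<lambda>(g, x, y). \<bar>u (\<phi> g x) - u (\<phi> g y)\<bar>"
  let ?d = "\<lambda>p. dist (fst (snd p)) (snd (snd p))"
  let ?Z = "{p \<in> topspace ?P. ?f p \<in> {\<epsilon>..}}"
  have "compact_space (euclidean :: ('s \<times> 's) topology)"
    using compact_Times[OF compact_UNIV compact_UNIV] by (simp add: compact_space_def)
  then have cP: "compact_space ?P"
    using compact_group by (simp add: compact_space_prod_topology compact_topological_group_def)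
  have act: "continuous_map ?P euclideanreal (\<lambda>p. u (\<phi> (fst p) (k (snd p))))"
    if k: "continuous_on UNIV k" for k :: "'s \<times> 's \<Rightarrow> 's"
  proof -
    have "continuous_map ?P euclidean (k \<circ> snd)"
      using k by (intro continuous_map_compose[OF continuous_map_snd]) simp
    then have "continuous_map ?P (prod_topology T euclidean) (\<lambda>p. (fst p, k (snd p)))"
      by (intro continuous_map_pairedI) (simp_all add: continuous_map_fst o_def)
    from continuous_map_compose[OF this continuous[unfolded continuous_action_def]]
    have "continuous_map ?P euclidean (\<lambda>p. \<phi> (fst p) (k (snd p)))"
      by (simp add: o_def)
    from continuous_map_compose[OF this, of euclideanreal u]
    show ?thesis using u by (simp add: o_def)
  qed
  have "continuous_map ?P euclideanreal (\<lambda>p. \<bar>u (\<phi> (fst p) (fst (snd p))) - u (\<phi> (fst p) (snd (snd p)))\<bar>)"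
    by (intro continuous_map_real_abs continuous_map_diff act continuous_intros)
  then have "continuous_map ?P euclideanreal ?f"
    by (simp add: case_prod_unfold)
  then have "closedin ?P ?Z"
    by (rule closedin_continuous_map_preimage) simp
  then have "compactin ?P ?Z"
    using cP by (rule closedin_compact_space[rotated])
  moreover have "continuous_map ?P euclideanreal ?d"
  proof -
    have "continuous_map euclidean euclideanreal (\<lambda>q::'s \<times> 's. dist (fst q) (snd q))"
      by (simp, intro continuous_intros)
    from continuous_map_compose[OF continuous_map_snd[of T] this]
    show ?thesis by (simp add: o_def)
  qed
  ultimately have "compactin euclideanreal (?d ` ?Z)"
    by (rule image_compactin)
  then have "closed (?d ` ?Z)"
    by (intro compact_imp_closed) simp
  moreover have "0 \<notin> ?d ` ?Z"
    using \<open>0 < \<epsilon>\<close> by auto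
  ultimately have "\<exists>\<delta>>0. \<forall>z\<in>?d ` ?Z. \<delta> \<le> dist 0 z"
    by (rule separate_point_closed)
  then obtain \<delta> where "0 < \<delta>" and \<delta>: "\<And>z. z \<in> ?d ` ?Z \<Longrightarrow> \<delta> \<le> dist 0 z"
    by blast
  have "\<bar>u (\<phi> g x) - u (\<phi> g y)\<bar> \<le> \<epsilon>" if "g \<in> carrier G" "dist x y < \<delta>" for g x y
  proof (rule ccontr)
    assume "\<not> ?thesis"
    then have "(g, x, y) \<in> ?Z"
      using that by (simp add: topspace_T)
    from imageI[OF this, of ?d] have "dist x y \<in> ?d ` ?Z"
      by simp
    from \<delta>[OF this] that show False by simp
  qed
  then show ?thesis
    using \<open>0 < \<delta>\<close> by (auto simp: translates_modulus_def)
qed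

text \<open>
  For fixed \<open>g\<close> the pairs \<open>(x, y)\<close> with \<open>g x\<close> close to \<open>y\<close> form an open set; by transitivity these
  sets cover the compact space \<open>\<Sigma> \<times> \<Sigma>\<close>.
\<close>
lemma finite_approximate_transitivity:
  assumes "0 < \<delta>"
  obtains I where "finite I" "I \<noteq> {}" "I \<subseteq> carrier G"
    "\<And>x y. \<exists>g\<in>I. dist (\<phi> g x) y < \<delta>"
proof -
  let ?U = "\<lambda>g. {p. dist (\<phi> g (fst p)) (snd p) < \<delta>}"
  have "open (?U g)" if "g \<in> carrier G" for g
  proof -
    have "continuous_on UNIV (\<lambda>p::'s \<times> 's. \<phi> g (fst p))"
      using continuous_on_compose2[OF continuous_translate[OF that] continuous_on_fst[OF continuous_on_id]]
      by simp
    then show ?thesis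
      by (intro open_Collect_less continuous_intros)
  qed
  moreover have "(UNIV :: ('s \<times> 's) set) \<subseteq> (\<Union>g\<in>carrier G. ?U g)"
  proof (clarify, simp)
    fix x y
    show "\<exists>g\<in>carrier G. dist (\<phi> g x) y < \<delta>"
      using unique_orbit[of x y] assms by force
  qed
  moreover have "compact (UNIV :: ('s \<times> 's) set)"
    using compact_Times[OF compact_UNIV compact_UNIV] by simp
  ultimately obtain I where I: "I \<subseteq> carrier G" "finite I" "UNIV \<subseteq> (\<Union>g\<in>I. ?U g)"
    using compactE_image[of UNIV "carrier G" ?U] by blast
  then have dense: "\<exists>g\<in>I. dist (\<phi> g x) y < \<delta>" for x y
    using subsetD[OF I(3), of "(x, y)"] by auto
  from dense have "I \<noteq> {}"
    by auto
  with that I dense show thesis by blast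
qed

section \<open>Averages of translates\<close>

definition average :: "'g set \<Rightarrow> ('s \<Rightarrow> real) \<Rightarrow> 's \<Rightarrow> real" where
  "average I u \<sigma> = (\<Sum>g\<in>I. u (\<phi> g \<sigma>)) / card I"

context
  fixes I :: "'g set"
  assumes I: "finite I" "I \<noteq> {}" "I \<subseteq> carrier G"
begin

lemma continuous_average:
  assumes u: "continuous_on UNIV u"
  shows "continuous_on UNIV (average I u)"
proof -
  have "continuous_on UNIV (\<lambda>\<sigma>. u (\<phi> g \<sigma>))" if "g \<in> I" for g
    using continuous_on_translate[OF _ u] that I by blast
  then show ?thesis
    unfolding average_def using I by (intro continuous_intros) auto
qed

lemma average_pos:
  "(\<And>\<sigma>. 0 < u \<sigma>) \<Longrightarrow> 0 < average I u \<sigma>"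
  unfolding average_def using I by (intro divide_pos_pos sum_pos) (auto simp: card_gt_0_iff)

lemma integral_average:
  assumes u: "continuous_on UNIV u"
  shows "(\<integral>\<sigma>. average I u \<sigma> \<partial>\<mu>) = (\<integral>\<sigma>. u \<sigma> \<partial>\<mu>)"
proof -
  have "(\<integral>\<sigma>. average I u \<sigma> \<partial>\<mu>) = (\<Sum>g\<in>I. \<integral>\<sigma>. u (\<phi> g \<sigma>) \<partial>\<mu>) / card I"
    unfolding average_def using I
    by (simp add: Bochner_Integration.integral_sum integrable_of_continuous continuous_on_translate[OF _ u] subset_iff)
  also have "\<dots> = (\<integral>\<sigma>. u \<sigma> \<partial>\<mu>)"
    using I integral_translate[OF _ u] by (simp add: subset_iff)
  finally show ?thesis .
qed

lemma translates_modulus_average: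
  assumes "translates_modulus u \<delta> \<epsilon>"
  shows "translates_modulus (average I u) \<delta> \<epsilon>"
  unfolding translates_modulus_def
proof (intro ballI allI impI)
  fix g and x y :: 's
  assume g: "g \<in> carrier G" and xy: "dist x y < \<delta>"
  have "\<bar>average I u (\<phi> g x) - average I u (\<phi> g y)\<bar>
      = \<bar>\<Sum>h\<in>I. u (\<phi> h (\<phi> g x)) - u (\<phi> h (\<phi> g y))\<bar> / card I"
    by (simp add: average_def sum_subtractf flip: diff_divide_distrib)
  also have "\<bar>\<Sum>h\<in>I. u (\<phi> h (\<phi> g x)) - u (\<phi> h (\<phi> g y))\<bar> \<le> (\<Sum>h\<in>I. \<epsilon>)"
  proof (rule order.trans[OF sum_abs], rule sum_mono)
    fix h assume "h \<in> I"
    then have h: "h \<in> carrier G" using I by auto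
    then have "h \<otimes>\<^bsub>G\<^esub> g \<in> carrier G"
      using g group_G by (simp add: group.is_monoid monoid.m_closed)
    with assms xy have "\<bar>u (\<phi> (h \<otimes>\<^bsub>G\<^esub> g) x) - u (\<phi> (h \<otimes>\<^bsub>G\<^esub> g) y)\<bar> \<le> \<epsilon>"
      by (simp add: translates_modulus_def)
    then show "\<bar>u (\<phi> h (\<phi> g x)) - u (\<phi> h (\<phi> g y))\<bar> \<le> \<epsilon>"
      using composition_rule g h by simp
  qed
  finally show "\<bar>average I u (\<phi> g x) - average I u (\<phi> g y)\<bar> \<le> \<epsilon>"
    using I by (simp add: divide_right_mono)
qed

text \<open>
  Some point \<open>x\<close> has \<open>u x\<close> at most the mean. One of the \<open>card I\<close> translates of \<open>\<sigma>\<close> lands near \<open>x\<close>, so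
  its term is at most the mean plus \<open>\<epsilon>\<close>; the other terms are bounded by \<open>M\<close>.
\<close>
lemma average_le_contraction:
  assumes u: "continuous_on UNIV u" and mod: "translates_modulus u \<delta> \<epsilon>"
    and dense: "\<And>x y. \<exists>g\<in>I. dist (\<phi> g x) y < \<delta>"
    and le: "\<And>\<sigma>. u \<sigma> \<le> M"
  shows "average I u \<sigma> \<le> (1 - 1 / card I) * M + (1 / card I) * ((\<integral>\<sigma>. u \<sigma> \<partial>\<mu>) + \<epsilon>)"
proof -
  let ?m = "\<integral>\<sigma>. u \<sigma> \<partial>\<mu>"
  obtain x where "\<And>y. u x \<le> u y"
    using continuous_attains_inf[OF compact_UNIV _ u] by auto
  then have x: "u x \<le> ?m"
    by (intro integral_ge_const integrable_of_continuous u) auto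
  obtain h where h: "h \<in> I" "dist (\<phi> h \<sigma>) x < \<delta>"
    using dense by blast
  \<comment> \<open>The modulus speaks of translates; the trivial translate gives \<open>u\<close> itself.\<close>
  have "\<bar>u (\<phi> \<one>\<^bsub>G\<^esub> (\<phi> h \<sigma>)) - u (\<phi> \<one>\<^bsub>G\<^esub> x)\<bar> \<le> \<epsilon>"
    using mod h group_G by (simp add: translates_modulus_def group.is_monoid monoid.one_closed)
  then have "u (\<phi> h \<sigma>) \<le> ?m + \<epsilon>"
    using x by (simp flip: id_eq_one)
  moreover have "(\<Sum>g\<in>I - {h}. u (\<phi> g \<sigma>)) \<le> (\<Sum>g\<in>I - {h}. M)"
    by (rule sum_mono) (rule le)
  moreover have "real (card (I - {h})) = real (card I) - 1"
    using I h by (simp add: of_nat_diff Suc_le_eq card_gt_0_iff)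
  ultimately have "(\<Sum>g\<in>I. u (\<phi> g \<sigma>)) \<le> (?m + \<epsilon>) + (real (card I) - 1) * M"
    using I h by (simp add: sum.remove)
  then have "average I u \<sigma> \<le> ((?m + \<epsilon>) + (real (card I) - 1) * M) / card I"
    unfolding average_def by (rule divide_right_mono) simp
  also have "\<dots> = (1 - 1 / card I) * M + (1 / card I) * (?m + \<epsilon>)"
    using I by (simp add: diff_divide_distrib add_divide_distrib left_diff_distrib)
  finally show ?thesis .
qed

end

text \<open>
  Let \<open>N = card I\<close> and let \<open>c\<close> be the mean plus \<open>\<epsilon>/2\<close>. Since an average has the same mean and
  modulus, the contraction can be iterated: the excess of the maximum over \<open>c\<close> shrinks by the
  factor \<open>1 - 1/N\<close> each time, and finally drops below \<open>\<epsilon>/2\<close>.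
\<close>
lemma exists_near_constant_average:
  assumes w: "continuous_on UNIV w" and "0 < \<epsilon>"
  obtains I n where "finite I" "I \<noteq> {}" "I \<subseteq> carrier G"
    "\<And>\<sigma>. (average I ^^ n) w \<sigma> \<le> (\<integral>\<sigma>. w \<sigma> \<partial>\<mu>) + \<epsilon>"
proof -
  have "0 < \<epsilon> / 2" using \<open>0 < \<epsilon>\<close> by simp
  from translates_modulus_exists[OF w this]
  obtain \<delta> where "0 < \<delta>" and mod: "translates_modulus w \<delta> (\<epsilon> / 2)" by auto
  from finite_approximate_transitivity[OF \<open>0 < \<delta>\<close>]
  obtain I where I: "finite I" "I \<noteq> {}" "I \<subseteq> carrier G"
    and dense: "\<And>x y. \<exists>g\<in>I. dist (\<phi> g x) y < \<delta>" by metis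
  let ?c = "(\<integral>\<sigma>. w \<sigma> \<partial>\<mu>) + \<epsilon> / 2" and ?q = "1 - 1 / real (card I)"
  obtain y where y: "\<And>x. w x \<le> w y"
    using continuous_attains_sup[OF compact_UNIV _ w] by auto
  define D where "D = w y - ?c"
  have iter: "continuous_on UNIV ((average I ^^ n) w) \<and>
      translates_modulus ((average I ^^ n) w) \<delta> (\<epsilon> / 2) \<and>
      (\<integral>\<sigma>. (average I ^^ n) w \<sigma> \<partial>\<mu>) = (\<integral>\<sigma>. w \<sigma> \<partial>\<mu>) \<and>
      (\<forall>\<sigma>. (average I ^^ n) w \<sigma> \<le> ?c + ?q ^ n * D)" for n
  proof (induction n)
    case 0
    then show ?case using w mod y by (simp add: D_def)
  next
    case (Suc n)
    let ?u = "(average I ^^ n) w"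
    have "average I ?u \<sigma> \<le> ?q * (?c + ?q ^ n * D) + (1 / card I) * ?c" for \<sigma>
      using average_le_contraction[OF I, of ?u \<delta> "\<epsilon> / 2" "?c + ?q ^ n * D"] Suc dense by simp
    also have "?q * (?c + ?q ^ n * D) + (1 / card I) * ?c = ?c + ?q ^ Suc n * D"
      by (simp add: algebra_simps)
    finally show ?case
      using Suc continuous_average[OF I] translates_modulus_average[OF I] integral_average[OF I]
      by simp
  qed
  have "0 \<le> ?q" "?q < 1"
    using I by (auto simp: card_gt_0_iff Suc_le_eq)
  then have "(\<lambda>n. ?q ^ n * D) \<longlonglongrightarrow> 0 * D"
    by (intro tendsto_intros LIMSEQ_realpow_zero)
  then have "\<forall>\<^sub>F n in sequentially. ?q ^ n * D < \<epsilon> / 2"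
    using \<open>0 < \<epsilon>\<close> by (intro order_tendstoD) auto
  then obtain n where n: "?q ^ n * D < \<epsilon> / 2"
    by (auto simp: eventually_sequentially)
  have "(average I ^^ n) w \<sigma> \<le> (\<integral>\<sigma>. w \<sigma> \<partial>\<mu>) + \<epsilon>" for \<sigma>
  proof -
    have "(average I ^^ n) w \<sigma> \<le> ?c + ?q ^ n * D" using iter by blast
    with n show ?thesis by linarith
  qed
  with that I show thesis by blast
qed

section \<open>Partition functions with a weight\<close>

definition weighted_partition :: "('s \<Rightarrow> real) \<Rightarrow> ('s \<Rightarrow> real) \<Rightarrow> real" where
  "weighted_partition u H = (\<integral>\<sigma>. exp (H \<sigma>) * u \<sigma> \<partial>\<mu>)"

lemma integrable_exp_mult:
  assumes "continuous_on UNIV (H :: 's \<Rightarrow> real)" "continuous_on UNIV (u :: 's \<Rightarrow> real)"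
  shows "integrable \<mu> (\<lambda>\<sigma>. exp (H \<sigma>) * u \<sigma>)"
  using assms by (intro integrable_of_continuous continuous_intros)

lemma weighted_partition_pos:
  assumes "continuous_on UNIV H" "continuous_on UNIV u" "\<And>\<sigma>. 0 < u \<sigma>"
  shows "0 < weighted_partition u H"
  unfolding weighted_partition_def
  using assms by (intro integral_pos_of_continuous continuous_intros) auto

lemma partition_function_pos:
  assumes "continuous_on UNIV H"
  shows "0 < partition_function \<mu> H"
  unfolding partition_function_def
  using assms by (intro integral_pos_of_continuous continuous_intros) auto

lemma weighted_partition_le:
  assumes "continuous_on UNIV H" "continuous_on UNIV u" "\<And>\<sigma>. u \<sigma> \<le> c"
  shows "weighted_partition u H \<le> c * partition_function \<mu> H"
proof -
  have "weighted_partition u H \<le> (\<integral>\<sigma>. exp (H \<sigma>) * c \<partial>\<mu>)"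
    unfolding weighted_partition_def
    using assms by (intro integral_mono integrable_exp_mult continuous_intros) auto
  then show ?thesis
    by (simp add: partition_function_def mult.commute)
qed

lemma weighted_partition_ge:
  assumes "continuous_on UNIV H" "continuous_on UNIV u" "\<And>\<sigma>. c \<le> u \<sigma>"
  shows "c * partition_function \<mu> H \<le> weighted_partition u H"
proof -
  have "(\<integral>\<sigma>. exp (H \<sigma>) * c \<partial>\<mu>) \<le> weighted_partition u H"
    unfolding weighted_partition_def
    using assms by (intro integral_mono integrable_exp_mult continuous_intros) auto
  then show ?thesis
    by (simp add: partition_function_def mult.commute)
qed

text \<open>
  Invariance of \<open>\<mu>\<close> moves a translation from the weight to the Hamiltonian.
\<close>
lemma weighted_partition_translate:
  assumes g: "g \<in> carrier G" and H: "continuous_on UNIV H" and u: "continuous_on UNIV u"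
  shows "weighted_partition (\<lambda>\<sigma>. u (\<phi> g \<sigma>)) H = weighted_partition u (\<lambda>\<sigma>. H (\<phi> (inv\<^bsub>G\<^esub> g) \<sigma>))"
proof -
  have inv: "inv\<^bsub>G\<^esub> g \<in> carrier G"
    using g group_G by (simp add: group.inv_closed)
  have "\<phi> (inv\<^bsub>G\<^esub> g) (\<phi> g \<sigma>) = \<sigma>" for \<sigma>
    using orbit_sym_aux[OF g] by simp
  moreover have "continuous_on UNIV (\<lambda>\<sigma>. exp (H (\<phi> (inv\<^bsub>G\<^esub> g) \<sigma>)) * u \<sigma>)"
    using u continuous_on_translate[OF inv H] by (intro continuous_intros)
  ultimately show ?thesis
    using integral_translate[OF g, of "\<lambda>\<sigma>. exp (H (\<phi> (inv\<^bsub>G\<^esub> g) \<sigma>)) * u \<sigma>"]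
    by (simp add: weighted_partition_def)
qed

lemma weighted_partition_average:
  assumes I: "finite I" "I \<noteq> {}" "I \<subseteq> carrier G"
    and H: "continuous_on UNIV H" and u: "continuous_on UNIV u"
  shows "weighted_partition (average I u) H
       = (\<Sum>g\<in>I. weighted_partition (\<lambda>\<sigma>. u (\<phi> g \<sigma>)) H) / card I"
proof -
  have "integrable \<mu> (\<lambda>\<sigma>. exp (H \<sigma>) * u (\<phi> g \<sigma>))" if "g \<in> I" for g
    using that I by (intro integrable_exp_mult H continuous_on_translate u) auto
  then show ?thesis
    by (simp add: weighted_partition_def average_def sum_distrib_left
        Bochner_Integration.integral_sum)
qed

end

section \<open>The free energy as a functional of the weight\<close>

locale invariant_hamiltonian = compact_homogeneous_space G T \<phi> \<mu>
  for G :: "('g, 'm) monoid_scheme" and T :: "'g topology"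
    and \<phi> :: "'g \<Rightarrow> 's::metric_space \<Rightarrow> 's" and \<mu> :: "'s measure" +
  fixes L :: "('s \<Rightarrow> real) measure"
  assumes law: "hamiltonian_law L"
    and law_invariant: "invariant_law G \<phi> L"
    and finite_energy: "finite_free_energy \<mu> L"
begin

sublocale L: prob_space L
  using law by (simp add: hamiltonian_law_def)

lemma sets_L: "sets L = sets hamiltonian_space"
  using law by (simp add: hamiltonian_law_def)

lemma continuous_of_space_L: "H \<in> space L \<Longrightarrow> continuous_on UNIV H"
  using sets_eq_imp_space_eq[OF sets_L] by (simp add: space_hamiltonian_space)

definition weighted_free_energy :: "('s \<Rightarrow> real) \<Rightarrow> real" where
  "weighted_free_energy u = (\<integral>H. ln (weighted_partition u H) \<partial>L)"

text \<open>
  A positive continuous weight lies between two positive constants, so its logarithmic partition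
  function differs from \<open>log Z\<close> by a bounded amount.
\<close>
lemma integrable_ln_weighted_partition:
  assumes u: "continuous_on UNIV u" and pos: "\<And>\<sigma>. 0 < u \<sigma>"
    and meas: "weighted_partition u \<in> borel_measurable L"
  shows "integrable L (\<lambda>H. ln (weighted_partition u H))"
proof -
  obtain x y where x: "\<And>\<sigma>. u x \<le> u \<sigma>" and y: "\<And>\<sigma>. u \<sigma> \<le> u y"
    using continuous_attains_inf[OF compact_UNIV _ u] continuous_attains_sup[OF compact_UNIV _ u]
    by auto
  let ?Z = "partition_function \<mu>"
  have int: "integrable L (\<lambda>H. \<bar>ln (?Z H)\<bar> + (\<bar>ln (u x)\<bar> + \<bar>ln (u y)\<bar>))"
    using finite_energy by (simp add: finite_free_energy_def)
  show ?thesis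
  proof (rule Bochner_Integration.integrable_bound[OF int])
    show "(\<lambda>H. ln (weighted_partition u H)) \<in> borel_measurable L"
      using meas by measurable
    show "AE H in L. norm (ln (weighted_partition u H))
        \<le> norm (\<bar>ln (?Z H)\<bar> + (\<bar>ln (u x)\<bar> + \<bar>ln (u y)\<bar>))"
    proof (rule AE_I2)
      fix H assume "H \<in> space L"
      then have H: "continuous_on UNIV H" by (rule continuous_of_space_L)
      have Z: "0 < ?Z H" using H by (rule partition_function_pos)
      have "ln (u x * ?Z H) \<le> ln (weighted_partition u H)"
        using weighted_partition_ge[OF H u x] pos[of x] Z by (intro ln_mono) auto
      moreover have "ln (weighted_partition u H) \<le> ln (u y * ?Z H)"
        using weighted_partition_le[OF H u y] weighted_partition_pos[OF H u pos]
        by (intro ln_mono) auto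
      ultimately show "norm (ln (weighted_partition u H))
          \<le> norm (\<bar>ln (?Z H)\<bar> + (\<bar>ln (u x)\<bar> + \<bar>ln (u y)\<bar>))"
        using pos[of x] pos[of y] Z by (simp add: ln_mult)
    qed
  qed
qed

text \<open>
  A translation of the weight is an inverse translation of \<open>H\<close>, which leaves the law of \<open>H\<close>
  unchanged.
\<close>
lemma
  assumes g: "g \<in> carrier G" and u: "continuous_on UNIV u"
    and meas: "weighted_partition u \<in> borel_measurable L"
  shows measurable_weighted_partition_translate:
      "weighted_partition (\<lambda>\<sigma>. u (\<phi> g \<sigma>)) \<in> borel_measurable L"
    and weighted_free_energy_translate:
      "weighted_free_energy (\<lambda>\<sigma>. u (\<phi> g \<sigma>)) = weighted_free_energy u"
proof -
  let ?S = "\<lambda>H \<sigma>. H (\<phi> (inv\<^bsub>G\<^esub> g) \<sigma>)"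
  have inv: "inv\<^bsub>G\<^esub> g \<in> carrier G"
    using g group_G by (simp add: group.inv_closed)
  have S: "?S \<in> measurable L hamiltonian_space"
    using measurable_hamiltonian_shift[OF continuous_translate[OF inv]]
    by (simp cong: measurable_cong_sets add: sets_L)
  have eq: "weighted_partition (\<lambda>\<sigma>. u (\<phi> g \<sigma>)) H = weighted_partition u (?S H)"
    if "H \<in> space L" for H
    using weighted_partition_translate[OF g continuous_of_space_L[OF that] u] .
  have meas': "weighted_partition u \<in> borel_measurable hamiltonian_space"
    using meas by (simp cong: measurable_cong_sets add: sets_L)
  show "weighted_partition (\<lambda>\<sigma>. u (\<phi> g \<sigma>)) \<in> borel_measurable L"
    using measurable_compose[OF S meas'] by (simp add: eq cong: measurable_cong)
  have "weighted_free_energy (\<lambda>\<sigma>. u (\<phi> g \<sigma>)) = (\<integral>H. ln (weighted_partition u (?S H)) \<partial>L)"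
    unfolding weighted_free_energy_def by (intro Bochner_Integration.integral_cong) (simp_all add: eq)
  also have "\<dots> = (\<integral>H. ln (weighted_partition u H) \<partial>distr L hamiltonian_space ?S)"
    using meas' by (intro integral_distr[symmetric] S) measurable
  also have "distr L hamiltonian_space ?S = L"
    using law_invariant inv by (simp add: invariant_law_def)
  finally show "weighted_free_energy (\<lambda>\<sigma>. u (\<phi> g \<sigma>)) = weighted_free_energy u"
    by (simp add: weighted_free_energy_def)
qed

text \<open>
  Jensen's inequality for the logarithm: the partition function is linear in the weight, and all
  translates in the average have the same free energy as \<open>u\<close>.
\<close>
lemma
  assumes I: "finite I" "I \<noteq> {}" "I \<subseteq> carrier G"
    and u: "continuous_on UNIV u" and pos: "\<And>\<sigma>. 0 < u \<sigma>"
    and meas: "weighted_partition u \<in> borel_measurable L"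
  shows measurable_weighted_partition_average:
      "weighted_partition (average I u) \<in> borel_measurable L"
    and weighted_free_energy_le_average:
      "weighted_free_energy u \<le> weighted_free_energy (average I u)"
proof -
  let ?Z = "\<lambda>g. weighted_partition (\<lambda>\<sigma>. u (\<phi> g \<sigma>))"
  have carrier: "g \<in> carrier G" if "g \<in> I" for g
    using I that by auto
  have Z_meas: "?Z g \<in> borel_measurable L" if "g \<in> I" for g
    using measurable_weighted_partition_translate[OF carrier[OF that] u meas] .
  have Z_int: "integrable L (\<lambda>H. ln (?Z g H))" if "g \<in> I" for g
    using that carrier Z_meas pos
    by (intro integrable_ln_weighted_partition continuous_on_translate u) auto
  have eq: "weighted_partition (average I u) H = (\<Sum>g\<in>I. ?Z g H) / card I" if "H \<in> space L" for H
    using weighted_partition_average[OF I continuous_of_space_L[OF that] u] .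
  have "(\<lambda>H. (\<Sum>g\<in>I. ?Z g H) / card I) \<in> borel_measurable L"
    using Z_meas by measurable
  then show avg_meas: "weighted_partition (average I u) \<in> borel_measurable L"
    by (simp add: eq cong: measurable_cong)
  have jensen: "(\<Sum>g\<in>I. ln (?Z g H)) / card I \<le> ln (weighted_partition (average I u) H)"
    if H: "H \<in> space L" for H
  proof -
    have "0 < ?Z g H" if "g \<in> I" for g
      using that carrier pos
      by (intro weighted_partition_pos continuous_of_space_L[OF H] continuous_on_translate u) auto
    then have "(\<Sum>g\<in>I. (1 / card I) * ln (?Z g H)) \<le> ln (\<Sum>g\<in>I. (1 / card I) *\<^sub>R ?Z g H)"
      using I by (intro concave_on_sum[OF _ _ ln_concave]) auto
    then show ?thesis
      by (simp add: eq[OF H] sum_divide_distrib)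
  qed
  have "weighted_free_energy u = (\<Sum>g\<in>I. weighted_free_energy (\<lambda>\<sigma>. u (\<phi> g \<sigma>))) / card I"
    using I weighted_free_energy_translate[OF carrier u meas] by simp
  also have "\<dots> = (\<integral>H. (\<Sum>g\<in>I. ln (?Z g H)) / card I \<partial>L)"
    using Z_int by (simp add: weighted_free_energy_def Bochner_Integration.integral_sum)
  also have "\<dots> \<le> weighted_free_energy (average I u)"
    unfolding weighted_free_energy_def
  proof (rule integral_mono)
    show "integrable L (\<lambda>H. (\<Sum>g\<in>I. ln (?Z g H)) / card I)"
      using Z_int by simp
    show "integrable L (\<lambda>H. ln (weighted_partition (average I u) H))"
      using avg_meas continuous_average[OF I u] average_pos[OF I pos]
      by (rule integrable_ln_weighted_partition[rotated 2])
  qed (rule jensen)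
  finally show "weighted_free_energy u \<le> weighted_free_energy (average I u)" .
qed

text \<open>
  The nearly constant averages of \<open>w\<close> have at least the free energy of \<open>w\<close>, and at most the one of
  the constant weight \<open>\<integral> w d\<mu> + \<epsilon>\<close>. Passing to exponentials makes the limit \<open>\<epsilon> \<rightarrow> 0\<close> a statement about
  real numbers alone.
\<close>
theorem weighted_free_energy_le:
  assumes w: "continuous_on UNIV w" and pos: "\<And>\<sigma>. 0 < w \<sigma>"
    and meas: "weighted_partition w \<in> borel_measurable L"
  shows "weighted_free_energy w \<le> ln (\<integral>\<sigma>. w \<sigma> \<partial>\<mu>) + free_energy \<mu> L"
proof -
  let ?m = "\<integral>\<sigma>. w \<sigma> \<partial>\<mu>" and ?Z = "partition_function \<mu>"
  have m: "0 < ?m" using integral_pos_of_continuous[OF w pos] .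
  have "exp (weighted_free_energy w - free_energy \<mu> L) \<le> ?m"
  proof (rule field_le_epsilon)
    fix \<epsilon> :: real assume "0 < \<epsilon>"
    from exists_near_constant_average[OF w this] obtain I n
      where I: "finite I" "I \<noteq> {}" "I \<subseteq> carrier G"
      and le: "\<And>\<sigma>. (average I ^^ n) w \<sigma> \<le> ?m + \<epsilon>" by metis
    let ?u = "(average I ^^ n) w"
    have iter: "continuous_on UNIV ((average I ^^ k) w) \<and> (\<forall>\<sigma>. 0 < (average I ^^ k) w \<sigma>) \<and>
        weighted_partition ((average I ^^ k) w) \<in> borel_measurable L \<and>
        weighted_free_energy w \<le> weighted_free_energy ((average I ^^ k) w)" for k
    proof (induction k)
      case 0
      then show ?case using w pos meas by simp
    next
      case (Suc k)
      then show ?case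
        using continuous_average[OF I] average_pos[OF I] measurable_weighted_partition_average[OF I]
          weighted_free_energy_le_average[OF I] by (auto intro: order.trans)
    qed
    have u: "continuous_on UNIV ?u" "\<And>\<sigma>. 0 < ?u \<sigma>" "weighted_partition ?u \<in> borel_measurable L"
      using iter by auto
    have Z_int: "integrable L (\<lambda>H. ln (?Z H))"
      using finite_energy by (simp add: finite_free_energy_def)
    have "ln (weighted_partition ?u H) \<le> ln (?m + \<epsilon>) + ln (?Z H)" if "H \<in> space L" for H
    proof -
      have H: "continuous_on UNIV H" using that by (rule continuous_of_space_L)
      have "ln (weighted_partition ?u H) \<le> ln ((?m + \<epsilon>) * ?Z H)"
        using weighted_partition_le[OF H u(1) le] weighted_partition_pos[OF H u(1,2)]
        by (intro ln_mono) auto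
      then show ?thesis
        using m \<open>0 < \<epsilon>\<close> partition_function_pos[OF H] by (simp add: ln_mult)
    qed
    then have "weighted_free_energy ?u \<le> (\<integral>H. ln (?m + \<epsilon>) + ln (?Z H) \<partial>L)"
      unfolding weighted_free_energy_def using Z_int
      by (intro integral_mono integrable_ln_weighted_partition u) auto
    also have "\<dots> = ln (?m + \<epsilon>) + free_energy \<mu> L"
      using Z_int by (simp add: free_energy_def L.prob_space)
    finally have "weighted_free_energy w - free_energy \<mu> L \<le> ln (?m + \<epsilon>)"
      using iter[of n] by simp
    then have "exp (weighted_free_energy w - free_energy \<mu> L) \<le> exp (ln (?m + \<epsilon>))"
      by simp
    then show "exp (weighted_free_energy w - free_energy \<mu> L) \<le> ?m + \<epsilon>"
      using m \<open>0 < \<epsilon>\<close> by simp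
  qed
  then have "weighted_free_energy w - free_energy \<mu> L \<le> ln ?m"
    using m by (simp add: ln_ge_iff)
  then show ?thesis by simp
qed

end

section \<open>Subadditivity\<close>

theorem theorem1p1:
  fixes G :: "('g, 'm) monoid_scheme" and T :: "'g topology"
    and \<phi> :: "'g \<Rightarrow> 's::metric_space \<Rightarrow> 's"
    and \<mu> :: "'s measure"
    and L\<^sub>1 L\<^sub>2 :: "('s \<Rightarrow> real) measure"
  assumes "compact (UNIV :: 's set)"
    and "compact_topological_group G T"
    and "transitive_action G UNIV \<phi>"
    and "continuous_action T \<phi>"
    and "invariant_probability G \<phi> \<mu>"
    and "hamiltonian_law L\<^sub>1" and "hamiltonian_law L\<^sub>2"
    and "invariant_law G \<phi> L\<^sub>1"
    and "finite_free_energy \<mu> L\<^sub>1" and "finite_free_energy \<mu> L\<^sub>2"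
    and "finite_free_energy \<mu> (sum_law L\<^sub>1 L\<^sub>2)"
  shows "free_energy \<mu> (sum_law L\<^sub>1 L\<^sub>2) \<le> free_energy \<mu> L\<^sub>1 + free_energy \<mu> L\<^sub>2"
proof -
  interpret invariant_hamiltonian G T \<phi> \<mu> L\<^sub>1
    by (intro invariant_hamiltonian.intro compact_homogeneous_space.intro
        invariant_hamiltonian_axioms.intro assms)
  interpret L2: prob_space L\<^sub>2
    using assms by (simp add: hamiltonian_law_def)
  interpret pair_prob_space L\<^sub>1 L\<^sub>2 ..
  let ?Z = "partition_function \<mu>"
  let ?f = "\<lambda>H\<^sub>1 H\<^sub>2. ln (?Z (\<lambda>\<sigma>. H\<^sub>1 \<sigma> + H\<^sub>2 \<sigma>))"
  have sum_meas: "(\<lambda>(H\<^sub>1, H\<^sub>2) \<sigma>. H\<^sub>1 \<sigma> + H\<^sub>2 \<sigma>) \<in> measurable (L\<^sub>1 \<Otimes>\<^sub>M L\<^sub>2) hamiltonian_space"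
    using assms by (intro measurable_hamiltonian_sum)
  have sum_int: "integrable (sum_law L\<^sub>1 L\<^sub>2) (\<lambda>H. ln (?Z H))"
    using assms by (simp add: finite_free_energy_def)
  then have ln_meas: "(\<lambda>H. ln (?Z H)) \<in> borel_measurable hamiltonian_space"
    by (simp add: sum_law_def borel_measurable_integrable measurable_distr_eq1 integrable_iff_bounded)
  have f_int: "integrable (L\<^sub>1 \<Otimes>\<^sub>M L\<^sub>2) (case_prod ?f)"
    using integrable_distr[OF sum_meas sum_int[unfolded sum_law_def]]
    by (simp add: case_prod_unfold)
  have L2_int: "integrable L\<^sub>2 (\<lambda>H. ln (?Z H))"
    using assms by (simp add: finite_free_energy_def)
  have section_le: "(\<integral>H\<^sub>1. ?f H\<^sub>1 H\<^sub>2 \<partial>L\<^sub>1) \<le> ln (?Z H\<^sub>2) + free_energy \<mu> L\<^sub>1"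
    if int: "integrable L\<^sub>1 (\<lambda>H\<^sub>1. ?f H\<^sub>1 H\<^sub>2)" and H2: "H\<^sub>2 \<in> space L\<^sub>2" for H\<^sub>2
  proof -
    have cont: "continuous_on UNIV H\<^sub>2"
      using H2 assms(7) sets_eq_imp_space_eq[of L\<^sub>2 hamiltonian_space]
      by (simp add: hamiltonian_law_def space_hamiltonian_space)
    let ?w = "\<lambda>\<sigma>. exp (H\<^sub>2 \<sigma>)"
    have Z_eq: "?Z (\<lambda>\<sigma>. H\<^sub>1 \<sigma> + H\<^sub>2 \<sigma>) = weighted_partition ?w H\<^sub>1" for H\<^sub>1
      by (simp add: partition_function_def weighted_partition_def exp_add)
    have w: "continuous_on UNIV ?w"
      using cont by (intro continuous_intros)
    \<comment> \<open>Measurability is read off from the integrable logarithm, as \<open>Z\<close> is positive.\<close>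
    have "weighted_partition ?w H\<^sub>1 = exp (?f H\<^sub>1 H\<^sub>2)" if "H\<^sub>1 \<in> space L\<^sub>1" for H\<^sub>1
      using weighted_partition_pos[OF continuous_of_space_L[OF that] w] by (simp add: Z_eq)
    moreover have "(\<lambda>H\<^sub>1. exp (?f H\<^sub>1 H\<^sub>2)) \<in> borel_measurable L\<^sub>1"
      using int by measurable
    ultimately have "weighted_partition ?w \<in> borel_measurable L\<^sub>1"
      by (simp cong: measurable_cong)
    from weighted_free_energy_le[OF w _ this] show ?thesis
      unfolding Z_eq by (simp add: weighted_free_energy_def partition_function_def)
  qed
  have "free_energy \<mu> (sum_law L\<^sub>1 L\<^sub>2) = integral\<^sup>L (L\<^sub>1 \<Otimes>\<^sub>M L\<^sub>2) (case_prod ?f)"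
    unfolding free_energy_def sum_law_def
    using integral_distr[OF sum_meas ln_meas] by (simp add: case_prod_unfold)
  also have "\<dots> = (\<integral>H\<^sub>2. (\<integral>H\<^sub>1. ?f H\<^sub>1 H\<^sub>2 \<partial>L\<^sub>1) \<partial>L\<^sub>2)"
    using integral_snd[OF f_int] by simp
  also have "\<dots> \<le> (\<integral>H\<^sub>2. ln (?Z H\<^sub>2) + free_energy \<mu> L\<^sub>1 \<partial>L\<^sub>2)"
  proof (rule integral_mono_AE)
    show "integrable L\<^sub>2 (\<lambda>H\<^sub>2. \<integral>H\<^sub>1. ?f H\<^sub>1 H\<^sub>2 \<partial>L\<^sub>1)"
      using integrable_snd[OF f_int] .
    show "integrable L\<^sub>2 (\<lambda>H\<^sub>2. ln (?Z H\<^sub>2) + free_energy \<mu> L\<^sub>1)"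
      using L2_int by simp
    show "AE H\<^sub>2 in L\<^sub>2. (\<integral>H\<^sub>1. ?f H\<^sub>1 H\<^sub>2 \<partial>L\<^sub>1) \<le> ln (?Z H\<^sub>2) + free_energy \<mu> L\<^sub>1"
      using AE_integrable_snd[OF f_int] AE_space
    proof eventually_elim
      case (elim H\<^sub>2)
      then show ?case by (rule section_le)
    qed
  qed
  also have "\<dots> = free_energy \<mu> L\<^sub>1 + free_energy \<mu> L\<^sub>2"
    using L2_int by (simp add: free_energy_def L2.prob_space)
  finally show ?thesis .
qed

end
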